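(* For every connected metric space $(X,d)$ the cobweb $\mathsf{Cob}(X,d)$ is a connected complete metric space whose separablewise components form a quotient space homeomorphic to $X$; that is, the set of separablewise components of $\mathsf{Cob}(X,d)$, with the quotient topology induced from $\mathsf{Cob}(X,d)$, is homeomorphic to $X$.
   Context: Complete oriented graph. For a set $X$ and distinct $x,y\in X$ the oriented edge is $[x,y]=\{x,y\}\cup\{(x,y,t): t\in(0,1)\}$, where the points $(x,y,t)$ are pairwise distinct for distinct triples and do not belong to $X$; thus $[x,y]\cap[y,x]=\{x,y\}$. Let $\Gamma(X)=X\cup\bigcup\{[x,y]: x,y\in X,\ x\ne y\}$. On pairs of points of a common edge define, for distinct $x,y\in X$ and $t,s\in(0,1)$: $r(x,x)=0$, $r(x,y)=1$, $r((x,y,t),(x,y,s))=|t-s|$, $r(x,(x,y,t))=r((x,y,t),x)=t$, $r(y,(x,y,t))=r((x,y,t),y)=1-t$. For $a,b\in\Gamma(X)$ let $\rho(a,b)$ be the infimum of $\sum_{i=1}^n r(a_i,a_{i-1})$ over all finite sequences $a=a_0,a_1,\dots,a_n=b$ in $\Gamma(X)$ such that any two consecutive points lie on a common edge (with $\rho(a,a)=0$). Then $\rho$ is a metric on $\Gamma(X)$ and each edge is isometric to $[0,1]$. Cobweb. Let $(X,d)$ be a metric space and $d_1=\min\{d,1/2\}$. For distinct $a,b\in X$ let $a_b\in[a,b]$ be the unique point with $\rho(a_b,b)=d_1(b,a)$, and let $[a,a_b]=\{z\in[a,b]:\rho(a,z)\le 1-d_1(b,a)\}$. Let $Z_a=\{a\}\cup\bigcup\{[a,a_b]\setminus\{b\}: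 b\in X\setminus\{a\}\}$. The cobweb over $(X,d)$ is $\mathsf{Cob}(X,d)=\bigcup_{a\in X}Z_a\subset\Gamma(X)$ with the metric $\rho$ restricted from $\Gamma(X)$. The separablewise component of a point $x_0$ of a topological space is the union of all separable connected subsets containing $x_0$; the separablewise components partition the space. *)

theory Defs
  imports "HOL-Analysis.Analysis"
begin

section \<open>The complete oriented graph over a set\<close>

text \<open>\<open>Inner x y t\<close> is the point \<open>(x,y,t)\<close> of the open oriented edge from \<open>x\<close> to \<open>y\<close>.
  It is a point of the graph over \<open>X\<close> only if \<open>x \<noteq> y\<close> are in \<open>X\<close> and \<open>0 < t < 1\<close>.\<close>

datatype 'a gpoint = Vert 'a | Inner 'a 'a real

definition oedge :: "'a \<Rightarrow> 'a \<Rightarrow> 'a gpoint set" where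
  "oedge x y = {Vert x, Vert y} \<union> {Inner x y t | t. 0 < t \<and> t < 1}"

definition ograph :: "'a set \<Rightarrow> 'a gpoint set" where
  "ograph X = Vert ` X \<union> \<Union>{oedge x y | x y. x \<in> X \<and> y \<in> X \<and> x \<noteq> y}"

definition common_oedge :: "'a set \<Rightarrow> 'a gpoint \<Rightarrow> 'a gpoint \<Rightarrow> bool" where
  "common_oedge X p q \<longleftrightarrow> (\<exists>x\<in>X. \<exists>y\<in>X. x \<noteq> y \<and> p \<in> oedge x y \<and> q \<in> oedge x y)"

text \<open>The length \<open>r\<close>; it is meaningful only for two points of a common edge. In the mixed
  cases the vertex \<open>z\<close> is then either the source \<open>x\<close> or the target \<open>y\<close>.\<close>

fun oedge_len :: "'a gpoint \<Rightarrow> 'a gpoint \<Rightarrow> real" where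
  "oedge_len (Vert x) (Vert y) = (if x = y then 0 else 1)"
| "oedge_len (Vert z) (Inner x y t) = (if z = x then t else 1 - t)"
| "oedge_len (Inner x y t) (Vert z) = (if z = x then t else 1 - t)"
| "oedge_len (Inner x y t) (Inner x' y' s) = \<bar>t - s\<bar>"

text \<open>The path metric \<open>\<rho>\<close>. The value \<open>n = 0\<close> contributes the empty sum for \<open>a = b\<close>.
  Outside the graph the value is set to 0, because the locale \<^locale>\<open>Metric_space\<close> demands
  nonnegativity and symmetry also outside the carrier.\<close>

definition ograph_dist :: "'a set \<Rightarrow> 'a gpoint \<Rightarrow> 'a gpoint \<Rightarrow> real" where
  "ograph_dist X a b =
     (if a \<in> ograph X \<and> b \<in> ograph X
      then Inf {(\<Sum>i=1..n. oedge_len (p i) (p (i - 1))) | n (p :: nat \<Rightarrow> 'a gpoint).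
                  p 0 = a \<and> p n = b \<and> (\<forall>i\<in>{1..n}. common_oedge X (p (i - 1)) (p i))}
      else 0)"

section \<open>The cobweb over a metric space\<close>

definition trunc_dist :: "('a \<Rightarrow> 'a \<Rightarrow> real) \<Rightarrow> 'a \<Rightarrow> 'a \<Rightarrow> real" where
  "trunc_dist d x y = min (d x y) (1/2)"

text \<open>The initial segment \<open>[a, a\<^sub>b]\<close> of the edge from \<open>a\<close> to \<open>b\<close>, whose endpoint \<open>a\<^sub>b\<close> is the
  point of this edge at distance \<open>trunc_dist d b a\<close> from \<open>b\<close>.\<close>

definition cob_segment :: "'a set \<Rightarrow> ('a \<Rightarrow> 'a \<Rightarrow> real) \<Rightarrow> 'a \<Rightarrow> 'a \<Rightarrow> 'a gpoint set" where
  "cob_segment X d a b =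
     {z \<in> oedge a b. ograph_dist X (Vert a) z \<le> 1 - trunc_dist d b a}"

definition cob_star :: "'a set \<Rightarrow> ('a \<Rightarrow> 'a \<Rightarrow> real) \<Rightarrow> 'a \<Rightarrow> 'a gpoint set" where
  "cob_star X d a = {Vert a} \<union> (\<Union>b\<in>X - {a}. cob_segment X d a b - {Vert b})"

definition cobweb :: "'a set \<Rightarrow> ('a \<Rightarrow> 'a \<Rightarrow> real) \<Rightarrow> 'a gpoint set" where
  "cobweb X d = (\<Union>a\<in>X. cob_star X d a)"

section \<open>Separablewise components and their quotient space\<close>

definition separablewise_component :: "'a topology \<Rightarrow> 'a \<Rightarrow> 'a set" where
  "separablewise_component T x =
     \<Union>{S. connectedin T S \<and> separable_space (subtopology T S) \<and> x \<in> S}"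

text \<open>The quotient (final) topology induced by a map \<open>q\<close> on the image of the space.\<close>

definition quotient_topology :: "'a topology \<Rightarrow> ('a \<Rightarrow> 'b) \<Rightarrow> 'b topology" where
  "quotient_topology T q =
     topology (\<lambda>U. U \<subseteq> q ` topspace T \<and> openin T {x \<in> topspace T. q x \<in> U})"

lemma openin_quotient_topology:
  "openin (quotient_topology T q) U \<longleftrightarrow>
     U \<subseteq> q ` topspace T \<and> openin T {x \<in> topspace T. q x \<in> U}"
proof -
  have "istopology (\<lambda>U. U \<subseteq> q ` topspace T \<and> openin T {x \<in> topspace T. q x \<in> U})"
    unfolding istopology_def
  proof (intro conjI allI impI)
    fix U V
    assume "U \<subseteq> q ` topspace T \<and> openin T {x \<in> topspace T. q x \<in> U}"
      and "V \<subseteq> q ` topspace T \<and> openin T {x \<in> topspace T. q x \<in> V}"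
    moreover have "{x \<in> topspace T. q x \<in> U \<inter> V} =
        {x \<in> topspace T. q x \<in> U} \<inter> {x \<in> topspace T. q x \<in> V}" by auto
    ultimately show "U \<inter> V \<subseteq> q ` topspace T" "openin T {x \<in> topspace T. q x \<in> U \<inter> V}"
      by auto
  next
    fix \<K>
    assume K: "\<forall>K\<in>\<K>. K \<subseteq> q ` topspace T \<and> openin T {x \<in> topspace T. q x \<in> K}"
    then show "\<Union>\<K> \<subseteq> q ` topspace T" by auto
    have "{x \<in> topspace T. q x \<in> \<Union>\<K>} = (\<Union>K\<in>\<K>. {x \<in> topspace T. q x \<in> K})" by auto
    with K show "openin T {x \<in> topspace T. q x \<in> \<Union>\<K>}" by auto
  qed
  then show ?thesis
    by (simp add: quotient_topology_def topology_inverse')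
qed

lemma topspace_quotient_topology: "topspace (quotient_topology T q) = q ` topspace T"
proof
  show "topspace (quotient_topology T q) \<subseteq> q ` topspace T"
    using openin_quotient_topology[of T q "topspace (quotient_topology T q)"] by simp
  have "{x \<in> topspace T. q x \<in> q ` topspace T} = topspace T" by auto
  then have "openin (quotient_topology T q) (q ` topspace T)"
    by (simp add: openin_quotient_topology)
  then show "q ` topspace T \<subseteq> topspace (quotient_topology T q)"
    by (rule openin_subset)
qed

lemma quotient_map_quotient_topology: "quotient_map T (quotient_topology T q) q"
  by (auto simp: quotient_map_def topspace_quotient_topology openin_quotient_topology)

text \<open>The set of separablewise components with the quotient topology.\<close>

definition separablewise_component_space :: "'a topology \<Rightarrow> 'a set topology" where
  "separablewise_component_space T = quotient_topology T (separablewise_component T)"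

end

theory Submission
  imports Defs
begin

text \<open>
The cobweb is the disjoint union of the stars \<open>cob_star X d a\<close>, \<open>a \<in> X\<close>, and everything rests on
the map \<open>home\<close> that sends each star to its centre. A spoke of the star of \<open>b\<close> that points
towards \<open>a\<close> ends at distance \<open>trunc_dist d b a\<close> from the vertex \<open>a\<close>. So the points of the cobweb
within \<open>r \<le> 1/2\<close> of the vertex \<open>a\<close> have exactly the points of the \<open>r\<close>-ball about \<open>a\<close> as homes
(\<open>home_near_vertex\<close>, \<open>vertex_near_home\<close>); away from the vertices \<open>home\<close> is locally constant. Hence
\<open>home\<close> is a quotient map onto \<open>X\<close> (\<open>quotient_map_home\<close>). Its fibres, the stars, are connected, and
a quotient map with connected fibres pulls connectedness of \<open>X\<close> back to the cobweb.

The fibres are also the separablewise components. Two points of one star lie on the union of two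
spokes, which is connected and separable. Conversely let \<open>S\<close> be connected and separable. Open spokes
and open unit balls about vertices are neighbourhoods, so each star that meets \<open>S\<close> is detected by a
point of a countable dense subset of \<open>S\<close>, and each point detects at most two stars; so \<open>home ` S\<close> is
countable. It is also connected, and a countable connected subset of a metric space has at most one
point. Thus the component map and \<open>home\<close> are quotient maps with the same fibres, and their
quotients are homeomorphic.

The path metric needs no closed formula. A single edge bounds it from above, and any real function
that is 1-Lipschitz along every edge bounds it from below. Two families of such functions are enough:
\<open>vdist z\<close>, the distance to the vertex \<open>z\<close> cut off at 1, and \<open>bump x y\<close>, which is positive exactly on
the open edge from \<open>x\<close> to \<open>y\<close>. For completeness, a Cauchy sequence either comes back again and again
to points at distance at least some \<open>e > 0\<close> from all vertices, and then it stays inside one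
edge, or it approaches the set of vertices, which are at mutual distance 1, and then it converges
to one vertex.
\<close>

section \<open>The path metric\<close>

text \<open>The lengths of polygonal paths as an inductive predicate: concatenating, reversing and
  estimating paths become inductions without index arithmetic.\<close>

inductive chain :: "'a set \<Rightarrow> 'a gpoint \<Rightarrow> 'a gpoint \<Rightarrow> real \<Rightarrow> bool" for X where
  chain_refl: "chain X a a 0"
| chain_step: "chain X a b l \<Longrightarrow> common_oedge X b c \<Longrightarrow> chain X a c (l + oedge_len c b)"

lemma chain_iff_path:
  "chain X a b l \<longleftrightarrow>
     (\<exists>n (p :: nat \<Rightarrow> 'a gpoint). l = (\<Sum>i=1..n. oedge_len (p i) (p (i - 1))) \<and>
        p 0 = a \<and> p n = b \<and> (\<forall>i\<in>{1..n}. common_oedge X (p (i - 1)) (p i)))"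
proof
  assume "chain X a b l"
  then show "\<exists>n (p :: nat \<Rightarrow> 'a gpoint). l = (\<Sum>i=1..n. oedge_len (p i) (p (i - 1))) \<and>
        p 0 = a \<and> p n = b \<and> (\<forall>i\<in>{1..n}. common_oedge X (p (i - 1)) (p i))"
  proof (induction rule: chain.induct)
    case (chain_refl a)
    show ?case by (intro exI[of _ "0::nat"] exI[of _ "\<lambda>_::nat. a"]) simp
  next
    case (chain_step a b l c)
    then obtain n and p :: "nat \<Rightarrow> 'a gpoint"
      where p: "l = (\<Sum>i=1..n. oedge_len (p i) (p (i - 1)))" "p 0 = a" "p n = b"
      "\<forall>i\<in>{1..n}. common_oedge X (p (i - 1)) (p i)"
      by blast
    define p' where "p' = p(Suc n := c)"
    have "(\<Sum>i=1..n. oedge_len (p' i) (p' (i - 1))) = l"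
      unfolding p(1) p'_def by (intro sum.cong) auto
    then have "l + oedge_len c b = (\<Sum>i=1..Suc n. oedge_len (p' i) (p' (i - 1)))"
      using p(3) by (simp add: p'_def)
    moreover have "p' 0 = a" "p' (Suc n) = c"
      using p(2) by (auto simp: p'_def)
    moreover have "\<forall>i\<in>{1..Suc n}. common_oedge X (p' (i - 1)) (p' i)"
      using p(3,4) chain_step.hyps(2) by (auto simp: p'_def le_Suc_eq)
    ultimately show ?case by blast
  qed
next
  have "chain X (p 0) (p n) (\<Sum>i=1..n. oedge_len (p i) (p (i - 1)))"
    if "\<forall>i\<in>{1..n}. common_oedge X (p (i - 1)) (p i)" for n and p :: "nat \<Rightarrow> 'a gpoint"
    using that
  proof (induction n)
    case (Suc n)
    then have "common_oedge X (p n) (p (Suc n))" by force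
    then show ?case using Suc chain_step[of X "p 0" "p n" _ "p (Suc n)"] by simp
  qed (simp add: chain_refl)
  then show "\<exists>n (p :: nat \<Rightarrow> 'a gpoint). l = (\<Sum>i=1..n. oedge_len (p i) (p (i - 1))) \<and>
        p 0 = a \<and> p n = b \<and> (\<forall>i\<in>{1..n}. common_oedge X (p (i - 1)) (p i)) \<Longrightarrow> chain X a b l"
    by blast
qed

lemma ograph_dist_eq_Inf:
  assumes "a \<in> ograph X" "b \<in> ograph X"
  shows "ograph_dist X a b = Inf {l. chain X a b l}"
  using assms by (simp add: ograph_dist_def chain_iff_path)

lemma oedge_len_commute: "oedge_len p q = oedge_len q p"
  by (cases p; cases q) auto

lemma common_oedge_commute: "common_oedge X p q \<longleftrightarrow> common_oedge X q p"
  by (auto simp: common_oedge_def)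

lemma chain_edge: "common_oedge X a b \<Longrightarrow> chain X a b (oedge_len a b)"
  using chain_step[OF chain_refl, of X a b] by (simp add: oedge_len_commute)

lemma chain_trans:
  assumes "chain X b c m" "chain X a b l"
  shows "chain X a c (l + m)"
  using assms
proof (induction arbitrary: l)
  case (chain_step b c' m c)
  then show ?case
    using chain.chain_step[of X a c' "l + m" c] by (simp add: add.assoc)
qed simp

lemma chain_commute: "chain X a b l \<Longrightarrow> chain X b a l"
proof (induction rule: chain.induct)
  case (chain_step a b l c)
  then show ?case
    using chain_trans[OF chain_step.IH chain_edge[of X c b]]
    by (simp add: add.commute common_oedge_commute)
qed (rule chain_refl)

lemma ograph_Inner_iff:
  "Inner x y t \<in> ograph X \<longleftrightarrow> x \<in> X \<and> y \<in> X \<and> x \<noteq> y \<and> 0 < t \<and> t < 1"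
  by (auto simp: ograph_def oedge_def)

lemma ograph_Vert_iff: "Vert x \<in> ograph X \<longleftrightarrow> x \<in> X"
  by (auto simp: ograph_def oedge_def)

text \<open>Without a path between any two points the infimum that defines the path metric would be taken
  over the empty set and would be an arbitrary number.\<close>

lemma chain_exists:
  assumes "a \<in> ograph X" "b \<in> ograph X"
  obtains l where "chain X a b l"
proof -
  have to_vertex: "\<exists>x\<in>X. \<exists>l. chain X p (Vert x) l" if "p \<in> ograph X" for p
  proof (cases p)
    case (Inner x y t)
    then have "common_oedge X p (Vert x)"
      using that by (auto simp: common_oedge_def oedge_def ograph_Inner_iff)
    then show ?thesis
      using that Inner chain_edge by (fastforce simp: ograph_Inner_iff)
  qed (use that chain_refl in \<open>force simp: ograph_Vert_iff\<close>)
  obtain x y l m where xy: "x \<in> X" "y \<in> X" "chain X a (Vert x) l" "chain X b (Vert y) m"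
    using assms to_vertex by metis
  have "\<exists>k. chain X (Vert x) (Vert y) k"
  proof (cases "x = y")
    case False
    then have "common_oedge X (Vert x) (Vert y)"
      using xy by (auto simp: common_oedge_def oedge_def)
    then show ?thesis using chain_edge by blast
  qed (use chain_refl in blast)
  then show thesis
    using xy chain_trans chain_commute that by meson
qed

text \<open>The certificates for lower bounds: such a function cannot change along a path by more than the
  length of the path.\<close>

definition edgewise_short :: "'a set \<Rightarrow> ('a gpoint \<Rightarrow> real) \<Rightarrow> bool" where
  "edgewise_short X f \<longleftrightarrow> (\<forall>p q. common_oedge X p q \<longrightarrow> \<bar>f p - f q\<bar> \<le> oedge_len p q)"

lemma edgewise_short_chain:
  assumes "edgewise_short X f" "chain X a b l"
  shows "\<bar>f a - f b\<bar> \<le> l"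
  using assms(2)
proof induction
  case (chain_step a b l c)
  then have "\<bar>f b - f c\<bar> \<le> oedge_len c b"
    using assms(1) by (metis edgewise_short_def oedge_len_commute)
  then show ?case using chain_step.IH by linarith
qed simp

lemma edgewise_short_dist:
  assumes "edgewise_short X f" "a \<in> ograph X" "b \<in> ograph X"
  shows "\<bar>f a - f b\<bar> \<le> ograph_dist X a b"
  unfolding ograph_dist_eq_Inf[OF assms(2,3)]
proof (rule cInf_greatest)
  show "{l. chain X a b l} \<noteq> {}"
    using chain_exists[OF assms(2,3)] by blast
qed (use edgewise_short_chain[OF assms(1)] in simp)

lemma oedge_len_nonneg: "common_oedge X p q \<Longrightarrow> 0 \<le> oedge_len p q"
  by (auto simp: common_oedge_def oedge_def)

lemma edgewise_short_const: "edgewise_short X (\<lambda>_. 0)"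
  by (simp add: edgewise_short_def oedge_len_nonneg)

lemma ograph_dist_le_chain:
  assumes "a \<in> ograph X" "b \<in> ograph X" "chain X a b l"
  shows "ograph_dist X a b \<le> l"
  unfolding ograph_dist_eq_Inf[OF assms(1,2)]
proof (rule cInf_lower)
  show "bdd_below {l. chain X a b l}"
    using edgewise_short_chain[OF edgewise_short_const] by (intro bdd_belowI[of _ 0]) simp
qed (use assms(3) in simp)

lemma ograph_dist_le_edge:
  assumes "common_oedge X a b"
  shows "ograph_dist X a b \<le> oedge_len a b"
proof (rule ograph_dist_le_chain)
  show "a \<in> ograph X" "b \<in> ograph X"
    using assms by (auto simp: common_oedge_def ograph_def)
qed (rule chain_edge[OF assms])

text \<open>This is the distance to the vertex \<open>z\<close> cut off at 1. The cut-off makes it constant on the edges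
  that avoid \<open>z\<close>, so that no knowledge of shortest paths is needed.\<close>

fun vdist :: "'a \<Rightarrow> 'a gpoint \<Rightarrow> real" where
  "vdist z (Vert x) = (if x = z then 0 else 1)"
| "vdist z (Inner x y t) = (if x = z then t else if y = z then 1 - t else 1)"

text \<open>On the open edge from \<open>x\<close> to \<open>y\<close> this is the distance to the two endpoints. It vanishes
  elsewhere and so separates a point of this open edge from everything outside it.\<close>

fun bump :: "'a \<Rightarrow> 'a \<Rightarrow> 'a gpoint \<Rightarrow> real" where
  "bump x y (Vert z) = 0"
| "bump x y (Inner u v t) = (if u = x \<and> v = y then min t (1 - t) else 0)"

lemma edgewise_short_vdist: "edgewise_short X (vdist z)"
  by (auto simp: edgewise_short_def common_oedge_def oedge_def)

lemma edgewise_short_bump: "edgewise_short X (bump x y)"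
  by (auto simp: edgewise_short_def common_oedge_def oedge_def)

lemmas vdist_le_dist = edgewise_short_dist[OF edgewise_short_vdist]
lemmas bump_le_dist = edgewise_short_dist[OF edgewise_short_bump]

lemma ograph_dist_triangle:
  assumes "a \<in> ograph X" "b \<in> ograph X" "c \<in> ograph X"
  shows "ograph_dist X a c \<le> ograph_dist X a b + ograph_dist X b c"
proof -
  have "ograph_dist X a c - l \<le> m" if "chain X a b l" "chain X b c m" for l m
    using ograph_dist_le_chain[OF assms(1,3) chain_trans[OF that(2,1)]] by simp
  then have "ograph_dist X a c - l \<le> ograph_dist X b c" if "chain X a b l" for l
    unfolding ograph_dist_eq_Inf[OF assms(2,3)]
    using that chain_exists[OF assms(2,3)] by (intro cInf_greatest) blast+
  then have "ograph_dist X a c - ograph_dist X b c \<le> l" if "chain X a b l" for l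
    using that by fastforce
  then have "ograph_dist X a c - ograph_dist X b c \<le> ograph_dist X a b"
    unfolding ograph_dist_eq_Inf[OF assms(1,2)]
    using chain_exists[OF assms(1,2)] by (intro cInf_greatest) blast+
  then show ?thesis by simp
qed

lemma ograph_dist_commute: "ograph_dist X a b = ograph_dist X b a"
proof (cases "a \<in> ograph X \<and> b \<in> ograph X")
  case True
  have "{l. chain X a b l} = {l. chain X b a l}" using chain_commute by blast
  with True show ?thesis by (simp add: ograph_dist_eq_Inf)
qed (auto simp: ograph_dist_def)

lemma ograph_dist_self: "a \<in> ograph X \<Longrightarrow> ograph_dist X a a = 0"
  using ograph_dist_le_chain[OF _ _ chain_refl, of a X]
    edgewise_short_dist[OF edgewise_short_const, of a X a] by auto

text \<open>Leaving an open edge costs at least the distance to the nearer endpoint.\<close>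

lemma Inner_isolated:
  assumes "Inner x y t \<in> ograph X" "q \<in> ograph X"
    "ograph_dist X (Inner x y t) q < min t (1 - t)"
  obtains s where "q = Inner x y s"
proof -
  have "bump x y q > 0"
    using bump_le_dist[OF assms(1,2), of x y] assms(3) by auto
  then show thesis
    using that by (cases q) (auto split: if_splits)
qed

lemma ograph_dist_pos:
  assumes "p \<in> ograph X" "q \<in> ograph X" "p \<noteq> q"
  shows "0 < ograph_dist X p q"
proof (cases p)
  case (Vert z)
  then show ?thesis
    using vdist_le_dist[OF assms(1,2), of z] assms
    by (cases q) (auto simp: ograph_Inner_iff split: if_splits)
next
  case (Inner x y t)
  show ?thesis
  proof (rule ccontr)
    assume "\<not> ?thesis"
    then have 0: "ograph_dist X p q \<le> 0" by simp
    moreover have "0 < min t (1 - t)"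
      using assms(1) Inner by (simp add: ograph_Inner_iff)
    ultimately obtain s where "q = Inner x y s"
      using Inner_isolated[of x y t X q] assms(1,2) Inner by auto
    then show False
      using vdist_le_dist[OF assms(1,2), of x] Inner 0 assms(3) by auto
  qed
qed

lemma Metric_space_ograph: "Metric_space (ograph X) (ograph_dist X)"
proof
  fix a b c
  show "0 \<le> ograph_dist X a b"
    using edgewise_short_dist[OF edgewise_short_const, of a X b]
    by (cases "a \<in> ograph X \<and> b \<in> ograph X") (auto simp: ograph_dist_def)
  show "ograph_dist X a b = ograph_dist X b a"
    by (rule ograph_dist_commute)
  show "ograph_dist X a b = 0 \<longleftrightarrow> a = b" if "a \<in> ograph X" "b \<in> ograph X"
    using that ograph_dist_pos[of a X b] ograph_dist_self by fastforce
  show "ograph_dist X a c \<le> ograph_dist X a b + ograph_dist X b c"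
    if "a \<in> ograph X" "b \<in> ograph X" "c \<in> ograph X"
    using that by (rule ograph_dist_triangle)
qed

lemma ograph_dist_Inner_le:
  assumes "Inner x y t \<in> ograph X" "Inner x y s \<in> ograph X"
  shows "ograph_dist X (Inner x y t) (Inner x y s) \<le> \<bar>t - s\<bar>"
proof -
  have "common_oedge X (Inner x y t) (Inner x y s)"
    using assms unfolding common_oedge_def oedge_def ograph_Inner_iff by auto
  from ograph_dist_le_edge[OF this] show ?thesis by simp
qed

lemma ograph_dist_endpoints:
  assumes "Inner x y t \<in> ograph X"
  shows "ograph_dist X (Vert x) (Inner x y t) = t"
    and "ograph_dist X (Vert y) (Inner x y t) = 1 - t"
proof -
  have "common_oedge X (Vert x) (Inner x y t)" "common_oedge X (Vert y) (Inner x y t)"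
    using assms unfolding common_oedge_def oedge_def ograph_Inner_iff by auto
  then have "ograph_dist X (Vert x) (Inner x y t) \<le> t"
    "ograph_dist X (Vert y) (Inner x y t) \<le> 1 - t"
    using ograph_dist_le_edge assms by (fastforce simp: ograph_Inner_iff)+
  moreover have "Vert x \<in> ograph X" "Vert y \<in> ograph X" "x \<noteq> y"
    using assms by (auto simp: ograph_Inner_iff ograph_Vert_iff)
  ultimately show "ograph_dist X (Vert x) (Inner x y t) = t"
    and "ograph_dist X (Vert y) (Inner x y t) = 1 - t"
    using vdist_le_dist[OF _ assms, of "Vert x" x] vdist_le_dist[OF _ assms, of "Vert y" y] by auto
qed

lemma ograph_dist_Vert:
  assumes "x \<in> X" "y \<in> X" "x \<noteq> y"
  shows "ograph_dist X (Vert x) (Vert y) = 1"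
proof -
  have "common_oedge X (Vert x) (Vert y)"
    using assms unfolding common_oedge_def oedge_def by auto
  from ograph_dist_le_edge[OF this] show ?thesis
    using vdist_le_dist[of "Vert x" X "Vert y" x] assms by (simp add: ograph_Vert_iff)
qed

section \<open>Separable subspaces and countable connected sets\<close>

lemma separable_space_subtopology_iff:
  "S \<subseteq> topspace T \<Longrightarrow> separable_space (subtopology T S) \<longleftrightarrow>
     (\<exists>C. countable C \<and> C \<subseteq> S \<and> S \<subseteq> T closure_of C)"
  unfolding separable_space_def closure_of_subtopology
  by (simp add: Int_absorb1 inf.absorb_iff1 cong: conj_cong)

lemma separable_space_Un:
  assumes "S \<subseteq> topspace T" "S' \<subseteq> topspace T"
    "separable_space (subtopology T S)" "separable_space (subtopology T S')"
  shows "separable_space (subtopology T (S \<union> S'))"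
proof -
  obtain C C' where "countable C" "C \<subseteq> S" "S \<subseteq> T closure_of C"
    "countable C'" "C' \<subseteq> S'" "S' \<subseteq> T closure_of C'"
    using assms by (auto simp: separable_space_subtopology_iff)
  then have "countable (C \<union> C')" "C \<union> C' \<subseteq> S \<union> S'" "S \<union> S' \<subseteq> T closure_of (C \<union> C')"
    by auto
  then show ?thesis
    using assms(1,2) by (metis separable_space_subtopology_iff Un_least)
qed

text \<open>A connected metric space with two points surjects onto an interval, hence is uncountable.\<close>

lemma (in Metric_space) countable_connectedin_unique:
  assumes "connectedin mtopology S" "countable S" "a \<in> S" "b \<in> S"
  shows "a = b"
proof (rule ccontr)
  assume "a \<noteq> b"
  have "metrizable_space (subtopology mtopology S)"
    by (simp add: metrizable_space_mtopology metrizable_space_subtopology)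
  moreover have top: "topspace (subtopology mtopology S) = S" "connected_space (subtopology mtopology S)"
    using assms(1) by (auto simp: connectedin_def)
  ultimately have "(UNIV::real set) \<lesssim> topspace (subtopology mtopology S)"
    using assms(3,4) \<open>a \<noteq> b\<close>
    by (intro connected_space_imp_card_ge metrizable_imp_normal_space metrizable_imp_t1_space)
      auto
  then have "countable (UNIV :: real set)"
    using assms(2) top(1) countable_lepoll by metis
  then show False using uncountable_UNIV_real by blast
qed

section \<open>Points of the cobweb\<close>

text \<open>The centre of the star that contains a given point of the cobweb. An inner point of the edge from
  \<open>a\<close> to \<open>b\<close> belongs to the star of \<open>a\<close> even when it is nearer to \<open>b\<close>.\<close>

fun home :: "'a gpoint \<Rightarrow> 'a" where
  "home (Vert a) = a"
| "home (Inner a b t) = a"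

text \<open>The distance to the set of vertices, and a vertex that attains it.\<close>

fun height :: "'a gpoint \<Rightarrow> real" where
  "height (Vert x) = 0"
| "height (Inner x y t) = min t (1 - t)"

fun foot :: "'a gpoint \<Rightarrow> 'a" where
  "foot (Vert x) = x"
| "foot (Inner x y t) = (if t \<le> 1 - t then x else y)"

context Metric_space
begin

lemma trunc_dist_pos: "a \<in> M \<Longrightarrow> b \<in> M \<Longrightarrow> a \<noteq> b \<Longrightarrow> 0 < trunc_dist d b a"
  by (simp add: trunc_dist_def)

lemma Vert_in_cobweb_iff: "Vert a \<in> cobweb M d \<longleftrightarrow> a \<in> M"
  by (auto simp: cobweb_def cob_star_def cob_segment_def oedge_def)

text \<open>Here \<open>t < 1\<close> follows from the last bound, since \<open>trunc_dist d b a > 0\<close>: no spoke reaches its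
  target vertex.\<close>

lemma Inner_in_cobweb_iff:
  "Inner a b t \<in> cobweb M d \<longleftrightarrow>
     a \<in> M \<and> b \<in> M \<and> a \<noteq> b \<and> 0 < t \<and> t \<le> 1 - trunc_dist d b a"
proof -
  have "Inner a b t \<in> cobweb M d \<longleftrightarrow> a \<in> M \<and> b \<in> M \<and> a \<noteq> b \<and> 0 < t \<and> t < 1 \<and>
      ograph_dist M (Vert a) (Inner a b t) \<le> 1 - trunc_dist d b a"
    by (auto simp: cobweb_def cob_star_def cob_segment_def oedge_def)
  also have "\<dots> \<longleftrightarrow> Inner a b t \<in> ograph M \<and> t \<le> 1 - trunc_dist d b a"
    using ograph_dist_endpoints(1)[of a b t M] by (auto simp: ograph_Inner_iff)
  finally show ?thesis
    using trunc_dist_pos[of a b] by (auto simp: ograph_Inner_iff)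
qed

lemma cobweb_subset_ograph: "cobweb M d \<subseteq> ograph M"
proof
  fix p assume "p \<in> cobweb M d"
  then show "p \<in> ograph M"
    using trunc_dist_pos
    by (cases p) (fastforce simp: Vert_in_cobweb_iff Inner_in_cobweb_iff
        ograph_Inner_iff ograph_Vert_iff)+
qed

lemma home_in: "p \<in> cobweb M d \<Longrightarrow> home p \<in> M"
  by (cases p) (auto simp: Vert_in_cobweb_iff Inner_in_cobweb_iff)

interpretation Cob: Metric_space "cobweb M d" "ograph_dist M"
  using Metric_space.subspace[OF Metric_space_ograph cobweb_subset_ograph] .

text \<open>A point near the vertex \<open>a\<close> in a foreign star lies on the spoke from its home \<open>x\<close> to \<open>a\<close>. This
  spoke stops at distance \<open>min (d a x) (1/2)\<close> from \<open>a\<close>, so the point can be nearer than \<open>r \<le> 1/2\<close>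
  only if \<open>d a x < r\<close>.\<close>

lemma home_near_vertex:
  assumes "p \<in> cobweb M d" "a \<in> M" "ograph_dist M (Vert a) p < r" "r \<le> 1/2"
  shows "d a (home p) < r"
proof -
  have r: "vdist a p < r" "0 < r"
    using vdist_le_dist[of "Vert a" M p a] assms cobweb_subset_ograph
      Cob.nonneg[of "Vert a" p]
    by (auto simp: ograph_Vert_iff)
  show ?thesis
  proof (cases p)
    case (Inner x y t)
    then show ?thesis
      using r assms by (auto simp: Inner_in_cobweb_iff trunc_dist_def split: if_splits)
  qed (use r assms in \<open>auto split: if_splits\<close>)
qed

text \<open>For \<open>b \<noteq> a\<close> the witness is the end of the spoke from \<open>b\<close> towards \<open>a\<close>, at distance \<open>d a b\<close> from \<open>a\<close>. This is
  where the star of \<open>b\<close> comes near the star of \<open>a\<close>.\<close>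

lemma vertex_near_home:
  assumes "a \<in> M" "b \<in> M" "d a b < r" "r \<le> 1/2"
  obtains p where "p \<in> cobweb M d" "home p = b" "ograph_dist M (Vert a) p < r"
proof (cases "a = b")
  case True
  then show thesis
    using that[of "Vert a"] assms by (simp add: Vert_in_cobweb_iff)
next
  case False
  define p where "p = Inner b a (1 - d a b)"
  have "p \<in> cobweb M d"
    using assms False by (simp add: p_def Inner_in_cobweb_iff trunc_dist_def)
  then have "ograph_dist M (Vert a) p = d a b"
    using cobweb_subset_ograph ograph_dist_endpoints(2)[of b a "1 - d a b" M]
    by (auto simp: p_def)
  then show thesis
    using that \<open>p \<in> cobweb M d\<close> assms(3) by (simp add: p_def)
qed

lemma Inner_neighbourhood:
  assumes "Inner a b t \<in> cobweb M d"
  obtains r where "r > 0" "\<And>q. q \<in> Cob.mball (Inner a b t) r \<Longrightarrow> \<exists>s. q = Inner a b s"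
proof
  have og: "Inner a b t \<in> ograph M"
    using assms cobweb_subset_ograph by blast
  then show "min t (1 - t) > 0"
    by (simp add: ograph_Inner_iff)
  fix q assume "q \<in> Cob.mball (Inner a b t) (min t (1 - t))"
  then have "q \<in> ograph M" "ograph_dist M (Inner a b t) q < min t (1 - t)"
    using cobweb_subset_ograph by auto
  then show "\<exists>s. q = Inner a b s"
    using Inner_isolated[OF og] by metis
qed

text \<open>At vertices the two preceding estimates match small balls of the cobweb with small balls of the
  base space; at inner points \<open>home\<close> is locally constant.\<close>

lemma quotient_map_home: "quotient_map Cob.mtopology mtopology home"
  unfolding quotient_map_def
proof (intro conjI allI impI iffI)
  show "home ` topspace Cob.mtopology = topspace mtopology"
    using home_in by (force simp: image_iff Bex_def Vert_in_cobweb_iff intro: exI[of _ "Vert _"])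
next
  fix U
  assume "U \<subseteq> topspace mtopology"
    and op: "openin Cob.mtopology {p \<in> topspace Cob.mtopology. home p \<in> U}"
  then have U: "U \<subseteq> M" by simp
  show "openin mtopology U"
    unfolding openin_mtopology
  proof (intro conjI allI impI U)
    fix a assume a: "a \<in> U"
    with U have "Vert a \<in> {p \<in> topspace Cob.mtopology. home p \<in> U}"
      by (auto simp: Vert_in_cobweb_iff)
    with op obtain r where r: "r > 0" "Cob.mball (Vert a) r \<subseteq> {p \<in> cobweb M d. home p \<in> U}"
      unfolding Cob.openin_mtopology by auto
    define r' where "r' = min r (1/2)"
    have r': "0 < r'" "r' \<le> r" "r' \<le> 1/2"
      using r(1) by (auto simp: r'_def)
    have "mball a r' \<subseteq> U"
    proof
      fix b assume "b \<in> mball a r'"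
      then have "a \<in> M" "b \<in> M" "d a b < r'" by auto
      then obtain p where "p \<in> cobweb M d" "home p = b" "ograph_dist M (Vert a) p < r'"
        using r'(3) by (rule vertex_near_home)
      moreover from this have "p \<in> Cob.mball (Vert a) r"
        using r'(2) \<open>a \<in> M\<close> by (simp add: Vert_in_cobweb_iff)
      ultimately show "b \<in> U" using r(2) by blast
    qed
    then show "\<exists>r>0. mball a r \<subseteq> U"
      using r'(1) by blast
  qed
next
  fix U assume U: "openin mtopology U"
  let ?V = "{p \<in> topspace Cob.mtopology. home p \<in> U}"
  show "openin Cob.mtopology ?V"
    unfolding Cob.openin_mtopology
  proof (intro conjI allI impI)
    fix p assume p: "p \<in> ?V"
    show "\<exists>r>0. Cob.mball p r \<subseteq> ?V"
    proof (cases p)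
      case (Vert a)
      with p U obtain r where r: "r > 0" "mball a r \<subseteq> U"
        by (auto simp: openin_mtopology)
      have "Cob.mball p (min r (1/2)) \<subseteq> ?V"
      proof
        fix q assume "q \<in> Cob.mball p (min r (1/2))"
        then have "q \<in> cobweb M d" "d a (home q) < r"
          using home_near_vertex[of q a "min r (1/2)"] Vert by (auto simp: Vert_in_cobweb_iff)
        then show "q \<in> ?V"
          using r(2) p Vert home_in[of q] by (auto simp: Vert_in_cobweb_iff)
      qed
      then show ?thesis using r(1) by (intro exI[of _ "min r (1/2)"]) simp
    next
      case (Inner a b t)
      then obtain r where "r > 0" "\<And>q. q \<in> Cob.mball p r \<Longrightarrow> \<exists>s. q = Inner a b s"
        using p Inner_neighbourhood[of a b t] by auto
      then show ?thesis using p Inner by fastforce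
    qed
  qed auto
qed

section \<open>Stars and separablewise components\<close>

text \<open>The part of a spoke from its centre to \<open>p\<close> is the 1-Lipschitz image of a compact real
  interval.\<close>

lemma spoke_connected_separable:
  assumes "p \<in> cobweb M d"
  obtains S where "connectedin Cob.mtopology S" "separable_space (subtopology Cob.mtopology S)"
    "p \<in> S" "Vert (home p) \<in> S" "\<forall>q\<in>S. home q = home p"
proof (cases p)
  case (Vert a)
  have "separable_space (subtopology Cob.mtopology {p})"
    using assms closure_of_subset[of "{p}" Cob.mtopology]
    by (subst separable_space_subtopology_iff) (auto intro!: exI[of _ "{p}"])
  then show thesis
    using that[of "{p}"] Vert assms by simp
next
  case (Inner a b t)
  define f where "f s = (if s = 0 then Vert a else Inner a b s)" for s
  have ab: "a \<in> M" "b \<in> M" "a \<noteq> b" "0 < t" "t \<le> 1 - trunc_dist d b a"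
    using assms Inner by (auto simp: Inner_in_cobweb_iff)
  have f_in: "f s \<in> cobweb M d" if "s \<in> {0..t}" for s
    using that ab by (auto simp: f_def Vert_in_cobweb_iff Inner_in_cobweb_iff)
  have og: "Inner a b s \<in> ograph M" if "s \<in> {0<..t}" for s
    using f_in[of s] that cobweb_subset_ograph by (auto simp: f_def)
  have short: "ograph_dist M (f s) (f s') \<le> \<bar>s - s'\<bar>" if "s \<in> {0..t}" "s' \<in> {0..t}" for s s'
  proof -
    have d0: "ograph_dist M (Vert a) (f s) = s" if "s \<in> {0..t}" for s
      using that ab og[of s] ograph_dist_endpoints(1)[of a b s M] ograph_dist_self[of "Vert a" M]
      by (auto simp: f_def ograph_Vert_iff)
    consider "s = 0" | "s' = 0" | "s \<in> {0<..t}" "s' \<in> {0<..t}"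
      using \<open>s \<in> {0..t}\<close> \<open>s' \<in> {0..t}\<close> by force
    then show ?thesis
    proof cases
      case 1
      then show ?thesis using d0[OF that(2)] by (simp add: f_def)
    next
      case 2
      then show ?thesis
        using d0[OF that(1)] ograph_dist_commute[of M "f s" "Vert a"] by (simp add: f_def)
    next
      case 3
      then show ?thesis
        using ograph_dist_Inner_le[OF og[of s] og[of s']] by (simp add: f_def)
    qed
  qed
  have cont: "continuous_map (top_of_set {0..t}) Cob.mtopology f"
    unfolding Cob.continuous_map_to_metric
  proof (intro ballI allI impI)
    fix s \<epsilon> :: real assume s: "s \<in> topspace (top_of_set {0..t})" and "\<epsilon> > 0"
    have "f s' \<in> Cob.mball (f s) \<epsilon>" if "s' \<in> {0..t} \<inter> ball s \<epsilon>" for s'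
      using short[of s s'] f_in s that by (auto simp: dist_real_def)
    moreover have "openin (top_of_set {0..t}) ({0..t} \<inter> ball s \<epsilon>)"
      by (simp add: openin_open_Int)
    ultimately show "\<exists>U. openin (top_of_set {0..t}) U \<and> s \<in> U \<and> (\<forall>s'\<in>U. f s' \<in> Cob.mball (f s) \<epsilon>)"
      using s \<open>\<epsilon> > 0\<close> by (intro exI[of _ "{0..t} \<inter> ball s \<epsilon>"]) auto
  qed
  have "connectedin Cob.mtopology (f ` {0..t})"
    using connectedin_continuous_map_image[OF cont, of "{0..t}"]
    by (simp add: connectedin_subtopology)
  moreover have "separable_space (subtopology Cob.mtopology (f ` {0..t}))"
  proof (rule separable_space_continuous_map_image)
    obtain C where "countable C" "C \<subseteq> {0..t}" "{0..t} \<subseteq> closure C"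
      by (rule separable)
    then show "separable_space (top_of_set {0..t})"
      by (subst separable_space_subtopology_iff) auto
    show "continuous_map (top_of_set {0..t}) (subtopology Cob.mtopology (f ` {0..t})) f"
      using cont by (auto simp: continuous_map_in_subtopology)
    show "f ` topspace (top_of_set {0..t}) = topspace (subtopology Cob.mtopology (f ` {0..t}))"
      using f_in by auto
  qed
  moreover have "p \<in> f ` {0..t}" "Vert (home p) \<in> f ` {0..t}"
    using ab Inner by (auto simp: f_def image_iff intro: bexI[of _ t] bexI[of _ 0])
  moreover have "\<forall>q\<in>f ` {0..t}. home q = home p"
    using Inner by (auto simp: f_def)
  ultimately show thesis by (rule that)
qed

lemma connectedin_star:
  assumes "a \<in> M"
  shows "connectedin Cob.mtopology {p \<in> cobweb M d. home p = a}"
proof -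
  define \<S> where "\<S> = {S. connectedin Cob.mtopology S \<and> Vert a \<in> S \<and> (\<forall>q\<in>S. home q = a)}"
  have "connectedin Cob.mtopology (\<Union>\<S>)"
    by (rule connectedin_Union) (auto simp: \<S>_def)
  moreover have "\<Union>\<S> = {p \<in> cobweb M d. home p = a}"
  proof (intro equalityI subsetI)
    fix p assume p: "p \<in> {p \<in> cobweb M d. home p = a}"
    then have "p \<in> cobweb M d" by simp
    then obtain S where "connectedin Cob.mtopology S"
      "separable_space (subtopology Cob.mtopology S)" "p \<in> S" "Vert (home p) \<in> S"
      "\<forall>q\<in>S. home q = home p"
      by (rule spoke_connected_separable)
    moreover have "home p = a" using p by simp
    ultimately show "p \<in> \<Union>\<S>"
      unfolding \<S>_def by blast
  next
    fix p assume "p \<in> \<Union>\<S>"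
    then show "p \<in> {p \<in> cobweb M d. home p = a}"
      using connectedin_subset_topspace by (fastforce simp: \<S>_def)
  qed
  ultimately show ?thesis by simp
qed

text \<open>Let \<open>C\<close> be a countable dense subset of \<open>S\<close>. If \<open>S\<close> meets the star of \<open>a\<close> in an inner point of a
  spoke, then \<open>C\<close> meets this open spoke. If it meets the star only in \<open>a\<close>, then \<open>C\<close> meets the open
  unit ball about \<open>a\<close>, which contains only \<open>a\<close> and inner points of edges at \<open>a\<close>. In both cases \<open>a\<close> is
  one of the at most two vertices that occur in some point of \<open>C\<close>; \<open>set_gpoint\<close> collects them.\<close>

lemma separable_imp_countable_home:
  assumes "S \<subseteq> cobweb M d" "separable_space (subtopology Cob.mtopology S)"
  shows "countable (home ` S)"
proof -
  obtain C where C: "countable C" "C \<subseteq> S" "S \<subseteq> Cob.mtopology closure_of C"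
    using assms separable_space_subtopology_iff[of S Cob.mtopology] by auto
  have near: "\<exists>w\<in>C. w \<in> Cob.mball p r" if "p \<in> S" "r > 0" for p r
    using C(3) that by (auto simp: Cob.metric_closure_of)
  have "home p \<in> (\<Union>w\<in>C. set_gpoint w)" if p: "p \<in> S" for p
  proof (cases p)
    case (Vert a)
    then obtain w where w: "w \<in> C" "w \<in> Cob.mball p 1"
      using near[OF p, of 1] by auto
    then have "vdist a w < 1"
      using vdist_le_dist[of p M w a] cobweb_subset_ograph[THEN subsetD, of p]
        cobweb_subset_ograph[THEN subsetD, of w] Vert by auto
    then have "a \<in> set_gpoint w"
      by (cases w) (auto split: if_splits)
    then show ?thesis using w Vert by auto
  next
    case (Inner a b t)
    then obtain r where r: "r > 0" "\<And>q. q \<in> Cob.mball p r \<Longrightarrow> \<exists>s. q = Inner a b s"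
      using p assms(1) Inner_neighbourhood[of a b t] by blast
    then obtain w s where "w \<in> C" "w = Inner a b s"
      using near[OF p r(1)] by blast
    then show ?thesis using Inner by force
  qed
  then have "home ` S \<subseteq> (\<Union>w\<in>C. set_gpoint w)" by blast
  moreover have "countable (set_gpoint w)" for w :: "'a gpoint"
    by (cases w) auto
  ultimately show ?thesis
    using C(1) by (meson countable_UN countable_subset)
qed

text \<open>The image under \<open>home\<close> of a connected separable set is connected and countable, so it is a
  single point; and two spokes meet in their common centre.\<close>

lemma separablewise_component_cobweb:
  assumes "p \<in> cobweb M d"
  shows "separablewise_component Cob.mtopology p = {q \<in> cobweb M d. home q = home p}"
proof (intro equalityI subsetI)
  fix q assume "q \<in> separablewise_component Cob.mtopology p"
  then obtain S where S: "connectedin Cob.mtopology S" "separable_space (subtopology Cob.mtopology S)"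
    "p \<in> S" "q \<in> S"
    by (auto simp: separablewise_component_def)
  have "S \<subseteq> cobweb M d"
    using connectedin_subset_topspace[OF S(1)] by simp
  moreover have "home q = home p"
  proof (rule countable_connectedin_unique)
    show "connectedin mtopology (home ` S)"
      using connectedin_continuous_map_image quotient_imp_continuous_map quotient_map_home S(1)
      by blast
    show "countable (home ` S)"
      using separable_imp_countable_home \<open>S \<subseteq> cobweb M d\<close> S(2) .
  qed (use S in auto)
  ultimately show "q \<in> {q \<in> cobweb M d. home q = home p}"
    using S(4) by auto
next
  fix q assume q: "q \<in> {q \<in> cobweb M d. home q = home p}"
  obtain S where S: "connectedin Cob.mtopology S" "separable_space (subtopology Cob.mtopology S)"
    "p \<in> S" "Vert (home p) \<in> S" "\<forall>q\<in>S. home q = home p"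
    using assms by (rule spoke_connected_separable)
  have "q \<in> cobweb M d" using q by simp
  then obtain S' where "connectedin Cob.mtopology S'"
    "separable_space (subtopology Cob.mtopology S')" "q \<in> S'" "Vert (home q) \<in> S'"
    "\<forall>z\<in>S'. home z = home q"
    by (rule spoke_connected_separable)
  moreover have "home q = home p" using q by simp
  ultimately have S': "connectedin Cob.mtopology S'"
    "separable_space (subtopology Cob.mtopology S')" "q \<in> S'" "Vert (home p) \<in> S'"
    by metis+
  have "connectedin Cob.mtopology (S \<union> S')"
    using S(1,4) S'(1,4) by (intro connectedin_Un) auto
  moreover have "separable_space (subtopology Cob.mtopology (S \<union> S'))"
    using S(1,2) S'(1,2) by (intro separable_space_Un connectedin_subset_topspace)
  ultimately show "q \<in> separablewise_component Cob.mtopology p"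
    using S(3) S'(3) unfolding separablewise_component_def by blast
qed

text \<open>Sending \<open>a\<close> to its star factors the component map through \<open>home\<close>. Both maps are quotient maps, so
  this factor is one too, and it is injective because each star contains its centre.\<close>

theorem separablewise_component_space_cobweb:
  "separablewise_component_space Cob.mtopology homeomorphic_space mtopology"
proof -
  define star where "star a = {q \<in> cobweb M d. home q = a}" for a
  have "quotient_map Cob.mtopology (separablewise_component_space Cob.mtopology)
      (separablewise_component Cob.mtopology)"
    unfolding separablewise_component_space_def by (rule quotient_map_quotient_topology)
  then have "quotient_map Cob.mtopology (separablewise_component_space Cob.mtopology) (star \<circ> home)"
    by (rule quotient_map_eq) (simp add: separablewise_component_cobweb star_def)
  then have "quotient_map mtopology (separablewise_component_space Cob.mtopology) star"
    using quotient_map_compose_eq[OF quotient_map_home] by blast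
  moreover have "inj_on star (topspace mtopology)"
  proof (rule inj_onI)
    fix a b assume a: "a \<in> topspace mtopology" and eq: "star a = star b"
    have "Vert a \<in> star a"
      using a by (simp add: star_def Vert_in_cobweb_iff)
    then have "Vert a \<in> star b"
      unfolding eq .
    then show "a = b" by (simp add: star_def)
  qed
  ultimately have "homeomorphic_map mtopology (separablewise_component_space Cob.mtopology) star"
    by (simp add: homeomorphic_map_def)
  then show ?thesis
    using homeomorphic_map_imp_homeomorphic_space homeomorphic_space_sym by blast
qed

text \<open>A separation of the cobweb cannot split a star, so it would descend along \<open>home\<close> to a separation
  of the base space.\<close>

theorem connected_space_cobweb:
  assumes "connected_space mtopology"
  shows "connected_space Cob.mtopology"
proof (rule connected_space_monotone_quotient_map_preimage)
  show "monotone_map Cob.mtopology mtopology home"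
    using home_in connectedin_star by (auto simp: monotone_map_def)
qed (rule quotient_map_home assms)+

section \<open>Completeness\<close>

lemma foot_height:
  assumes "p \<in> ograph M"
  shows "foot p \<in> M" "ograph_dist M (Vert (foot p)) p = height p"
  using assms ograph_dist_endpoints[of _ _ _ M] ograph_dist_self[of p M]
  by (cases p; force simp: ograph_Inner_iff ograph_Vert_iff)+

text \<open>The case distinction is whether the heights \<open>height (\<sigma> n)\<close> tend to 0.\<close>

lemma mcomplete_cobweb: "Cob.mcomplete"
  unfolding Cob.mcomplete_def
proof (intro allI impI)
  fix \<sigma> assume "Cob.MCauchy \<sigma>"
  then have "range \<sigma> \<subseteq> cobweb M d"
    and Cauchy': "\<forall>\<epsilon>>0. \<exists>N. \<forall>m n. N \<le> m \<longrightarrow> N \<le> n \<longrightarrow> ograph_dist M (\<sigma> m) (\<sigma> n) < \<epsilon>"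
    by (auto simp only: Cob.MCauchy_def)
  then have Cob: "\<sigma> n \<in> cobweb M d" for n by auto
  have Cauchy: "\<exists>N. \<forall>m\<ge>N. \<forall>n\<ge>N. ograph_dist M (\<sigma> m) (\<sigma> n) < \<epsilon>" if "\<epsilon> > 0" for \<epsilon>
    using Cauchy'[rule_format, OF that] by auto
  have og: "\<sigma> n \<in> ograph M" for n
    using Cob cobweb_subset_ograph by blast
  show "\<exists>x. limitin Cob.mtopology \<sigma> x sequentially"
  proof (cases "\<exists>e>0. \<forall>N. \<exists>n\<ge>N. e \<le> height (\<sigma> n)")
    case True
    then obtain e where e: "e > 0" "\<And>N. \<exists>n\<ge>N. e \<le> height (\<sigma> n)" by blast
    \<comment> \<open>From the height \<open>e\<close> steps shorter than \<open>e/2\<close> do not lead out of the edge, and the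
      positions on it stay in \<open>[e/2, 1 - trunc_dist d y x]\<close>, so the limit is not an endpoint.\<close>
    obtain N where N: "\<And>m n. m \<ge> N \<Longrightarrow> n \<ge> N \<Longrightarrow> ograph_dist M (\<sigma> m) (\<sigma> n) < e/2"
      using Cauchy[of "e/2"] e(1) by auto
    obtain n where n: "n \<ge> N" "e \<le> height (\<sigma> n)" using e(2) by blast
    then obtain x y t where xyt: "\<sigma> n = Inner x y t"
      using e(1) by (cases "\<sigma> n") auto
    have high: "e \<le> bump x y (\<sigma> n)"
      using n(2) xyt by simp
    define \<tau> where "\<tau> m = vdist x (\<sigma> m)" for m
    have \<tau>: "\<sigma> m = Inner x y (\<tau> m)" "e/2 \<le> \<tau> m" if "m \<ge> N" for m
    proof -
      have "e/2 < bump x y (\<sigma> m)"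
        using bump_le_dist[OF og og, of x y n m] N[OF n(1) that] high by linarith
      then show "\<sigma> m = Inner x y (\<tau> m)" "e/2 \<le> \<tau> m"
        using e(1) by (cases "\<sigma> m"; auto simp: \<tau>_def split: if_splits)+
    qed
    have "norm (\<tau> m - \<tau> n) \<le> ograph_dist M (\<sigma> m) (\<sigma> n)" for m n
      using vdist_le_dist[OF og og, of x] by (simp add: \<tau>_def)
    then have "\<exists>N. \<forall>m\<ge>N. \<forall>n\<ge>N. norm (\<tau> m - \<tau> n) < \<epsilon>" if "\<epsilon> > 0" for \<epsilon>
      using Cauchy[OF that] order_le_less_trans by blast
    then have "Cauchy \<tau>" by (rule CauchyI)
    then obtain L where L: "\<tau> \<longlonglongrightarrow> L"
      using real_Cauchy_convergent convergent_def by blast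
    have "e/2 \<le> L"
      using LIMSEQ_le_const[OF L] \<tau>(2) by blast
    moreover have "\<tau> m \<le> 1 - trunc_dist d y x" if "m \<ge> N" for m
      using Cob[of m] \<tau>(1)[OF that] Inner_in_cobweb_iff[of x y "\<tau> m"] by simp
    then have "L \<le> 1 - trunc_dist d y x"
      using LIMSEQ_le_const2[OF L] by blast
    ultimately have Lim: "Inner x y L \<in> cobweb M d"
      using Cob[of n] e(1) xyt by (simp add: Inner_in_cobweb_iff)
    have "limitin Cob.mtopology \<sigma> (Inner x y L) sequentially"
      unfolding Cob.limit_metric_sequentially
    proof (intro conjI allI impI Lim)
      fix \<epsilon> :: real assume "\<epsilon> > 0"
      then obtain N' where N': "\<And>m. m \<ge> N' \<Longrightarrow> \<bar>\<tau> m - L\<bar> < \<epsilon>"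
        using L unfolding LIMSEQ_iff real_norm_def by blast
      have "ograph_dist M (\<sigma> m) (Inner x y L) < \<epsilon>" if "m \<ge> max N N'" for m
        using ograph_dist_Inner_le[of x y "\<tau> m" M L] \<tau>(1)[of m] og[of m] N'[of m] that
          Lim cobweb_subset_ograph by fastforce
      then show "\<exists>N. \<forall>m\<ge>N. \<sigma> m \<in> cobweb M d \<and> ograph_dist M (\<sigma> m) (Inner x y L) < \<epsilon>"
        using Cob by blast
    qed
    then show ?thesis by blast
  next
    case False
    then have low: "\<exists>N. \<forall>n\<ge>N. height (\<sigma> n) < e" if "e > 0" for e
      using that by (meson not_le)
    \<comment> \<open>Three bounds of 1/3 put the feet of late terms at distance less than 1 from each other,
      which forces them to coincide.\<close>
    obtain N1 where N1: "\<And>n. n \<ge> N1 \<Longrightarrow> height (\<sigma> n) < 1/3"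
      using low[of "1/3"] by auto
    obtain N2 where N2: "\<And>m n. m \<ge> N2 \<Longrightarrow> n \<ge> N2 \<Longrightarrow> ograph_dist M (\<sigma> m) (\<sigma> n) < 1/3"
      using Cauchy[of "1/3"] by auto
    define N where "N = max N1 N2"
    define v where "v = foot (\<sigma> N)"
    have foot: "foot (\<sigma> n) = v" if "n \<ge> N" for n
    proof (rule ccontr)
      let ?f = "Vert (foot (\<sigma> n))"
      assume "foot (\<sigma> n) \<noteq> v"
      then have "1 = ograph_dist M ?f (Vert v)"
        using ograph_dist_Vert[of "foot (\<sigma> n)" M v] foot_height(1)[OF og] by (simp add: v_def)
      also have "\<dots> \<le> ograph_dist M ?f (\<sigma> n) + ograph_dist M (\<sigma> n) (Vert v)"
        using foot_height(1)[OF og] og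
        by (intro ograph_dist_triangle) (auto simp: v_def ograph_Vert_iff)
      also have "\<dots> \<le> ograph_dist M ?f (\<sigma> n) + (ograph_dist M (\<sigma> n) (\<sigma> N)
          + ograph_dist M (\<sigma> N) (Vert v))"
        using foot_height(1)[OF og] og
        by (intro add_left_mono ograph_dist_triangle) (auto simp: v_def ograph_Vert_iff)
      also have "\<dots> = height (\<sigma> n) + (ograph_dist M (\<sigma> n) (\<sigma> N) + height (\<sigma> N))"
        using foot_height(2)[OF og] by (simp add: v_def ograph_dist_commute)
      also have "\<dots> < 1"
        using N1[of n] N1[of N] N2[of n N] that by (simp add: N_def)
      finally show False by simp
    qed
    have v: "v \<in> M"
      using foot_height(1)[OF og] by (simp add: v_def)
    have "limitin Cob.mtopology \<sigma> (Vert v) sequentially"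
      unfolding Cob.limit_metric_sequentially
    proof (intro conjI allI impI)
      fix \<epsilon> :: real assume "\<epsilon> > 0"
      then obtain N' where N': "\<And>n. n \<ge> N' \<Longrightarrow> height (\<sigma> n) < \<epsilon>"
        using low by blast
      have "ograph_dist M (\<sigma> n) (Vert v) < \<epsilon>" if "n \<ge> max N N'" for n
        using foot_height(2)[OF og, of n] foot[of n] N'[of n] that
        by (simp add: ograph_dist_commute)
      then show "\<exists>N. \<forall>n\<ge>N. \<sigma> n \<in> cobweb M d \<and> ograph_dist M (\<sigma> n) (Vert v) < \<epsilon>"
        using Cob by blast
    qed (simp add: Vert_in_cobweb_iff v)
    then show ?thesis by blast
  qed
qed

lemma Metric_space_cobweb: "Metric_space (cobweb M d) (ograph_dist M)"
  by (rule Cob.Metric_space_axioms)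

end

theorem theorem2p9:
  fixes X :: "'a set" and d :: "'a \<Rightarrow> 'a \<Rightarrow> real"
  assumes "Metric_space X d"
    and "connected_space (Metric_space.mtopology X d)"
  shows "Metric_space (cobweb X d) (ograph_dist X) \<and>
    connected_space (Metric_space.mtopology (cobweb X d) (ograph_dist X)) \<and>
    Metric_space.mcomplete (cobweb X d) (ograph_dist X) \<and>
    separablewise_component_space (Metric_space.mtopology (cobweb X d) (ograph_dist X))
      homeomorphic_space Metric_space.mtopology X d"
  using Metric_space.Metric_space_cobweb[OF assms(1)]
    Metric_space.connected_space_cobweb[OF assms]
    Metric_space.mcomplete_cobweb[OF assms(1)]
    Metric_space.separablewise_component_space_cobweb[OF assms(1)]
  by blast

end
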